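(* Let $k$ be a field of characteristic zero, and let $\Delta$ be a simplicial complex on the $n$ vertices $x_1,\ldots,x_n$ with facets $\mathcal{F}(\Delta)=\{F_1,\ldots,F_t\}$, where $t\geq 2$ and no facet has cardinality one. Let $F_i=\{x_{i,1},\ldots,x_{i,d_i}\}$ denote the $i$th facet (so $d_i=|F_i|$ and each $x_{i,j}$ is one of $x_1,\ldots,x_n$). Then the algebra $A(\Delta,a_1,\ldots,a_n)$, with each $a_i\geq 2$ an integer, is level if and only if $(x_1,\ldots,x_n)=(a_1,\ldots,a_n)$ is a simultaneous integral solution to the following $t-1$ linear equations in the unknowns $x_1,\ldots,x_n$: $$(x_{i,1}+\cdots+x_{i,d_i})-(x_{i+1,1}+\cdots+x_{i+1,d_{i+1}})=d_i-d_{i+1},\qquad i=1,\ldots,t-1.$$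
   Context: A simplicial complex $\Delta$ on $V=\{x_1,\ldots,x_n\}$ is a collection of subsets of $V$ (faces) closed under taking subsets and with $\{x_i\}\in\Delta$ for all $i$; its facets are its faces that are maximal under inclusion. Let $R=k[x_1,\ldots,x_n]$ with $\deg x_i=1$. The Stanley-Reisner ideal is $I_\Delta=(x_{i_1}\cdots x_{i_s} \mid \{x_{i_1},\ldots,x_{i_s}\}\notin\Delta)\subseteq R$ (squarefree monomials). For integers $a_i\ge 2$, set $A(\Delta,a_1,\ldots,a_n)=R/(I_\Delta+(x_1^{a_1},\ldots,x_n^{a_n}))$, a graded artinian algebra. For a graded artinian algebra $A=R/I$, $\operatorname{soc}(A)=\{a\in A\mid a\overline{x}_i=0 \text{ for all } i\}$, and the socle-vector is $s(A)=(s_0,\ldots,s_e)$ with $s_i=\dim_k \operatorname{soc}(A)_i$, where $e$ is the largest index with $A_e\neq 0$. $A$ is level if $s_i=0$ for all $i\neq e$. *)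

theory Defs
  imports "HOL-Library.Poly_Mapping" "HOL-Algebra.Algebra" "HOL-Algebra.Algebraic_Closure_Type"
begin

section \<open>Simplicial complexes\<close>

text \<open>The vertices \<open>x\<^sub>1, \<dots>, x\<^sub>n\<close> are the elements of a finite type \<open>'v\<close>; thus \<open>n = CARD('v)\<close>.\<close>

definition simplicial_complex :: "'v::finite set set \<Rightarrow> bool" where
  "simplicial_complex \<Delta> \<longleftrightarrow> (\<forall>F\<in>\<Delta>. \<forall>G. G \<subseteq> F \<longrightarrow> G \<in> \<Delta>) \<and> (\<forall>v. {v} \<in> \<Delta>)"

definition facets :: "'v::finite set set \<Rightarrow> 'v set set" where
  "facets \<Delta> = {F \<in> \<Delta>. \<forall>G\<in>\<Delta>. F \<subseteq> G \<longrightarrow> G = F}"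

section \<open>The polynomial ring and its quotients\<close>

text \<open>Polynomials over \<open>'k\<close> in the variables \<open>'v\<close> map exponent vectors to coefficients.\<close>

type_synonym ('v, 'k) mpoly = "('v \<Rightarrow>\<^sub>0 nat) \<Rightarrow>\<^sub>0 'k"

abbreviation poly_ring :: "('v::finite, 'k::field) mpoly ring" where
  "poly_ring \<equiv> ring_of_type_algebra"

definition var :: "'v::finite \<Rightarrow> ('v, 'k::field) mpoly" where
  "var v = Poly_Mapping.single (Poly_Mapping.single v 1) 1"

definition const :: "'k::field \<Rightarrow> ('v::finite, 'k) mpoly" where
  "const c = Poly_Mapping.single 0 c"

definition homogeneous_polys :: "nat \<Rightarrow> ('v::finite, 'k::field) mpoly set" where
  "homogeneous_polys d =
     {f. \<forall>m \<in> Poly_Mapping.keys f. (\<Sum>v\<in>UNIV. Poly_Mapping.lookup m v) = d}"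

text \<open>
  In the following definitions \<open>I\<close> is a homogeneous ideal of the polynomial ring \<open>R\<close>
  and the subject is the graded algebra \<open>A = R/I\<close>.
\<close>

abbreviation quot_algebra :: "('v::finite, 'k::field) mpoly set \<Rightarrow> ('v, 'k) mpoly set ring" where
  "quot_algebra I \<equiv> poly_ring Quot I"

definition residue_class :: "('v::finite, 'k::field) mpoly set \<Rightarrow> ('v, 'k) mpoly \<Rightarrow> ('v, 'k) mpoly set" where
  "residue_class I f = I +>\<^bsub>poly_ring\<^esub> f"

definition graded_component :: "('v::finite, 'k::field) mpoly set \<Rightarrow> nat \<Rightarrow> ('v, 'k) mpoly set set" where
  "graded_component I d = residue_class I ` homogeneous_polys d"

text \<open>The image of the ground field in \<open>A\<close>; it is isomorphic to \<open>'k\<close> when \<open>I\<close> is proper.\<close>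

definition ground_field :: "('v::finite, 'k::field) mpoly set \<Rightarrow> ('v, 'k) mpoly set set" where
  "ground_field I = residue_class I ` range const"

section \<open>Socle and level algebras\<close>

definition socle :: "('v::finite, 'k::field) mpoly set \<Rightarrow> ('v, 'k) mpoly set set" where
  "socle I = {a \<in> carrier (quot_algebra I).
     \<forall>v. a \<otimes>\<^bsub>quot_algebra I\<^esub> residue_class I (var v) = \<zero>\<^bsub>quot_algebra I\<^esub>}"

definition socle_component :: "('v::finite, 'k::field) mpoly set \<Rightarrow> nat \<Rightarrow> ('v, 'k) mpoly set set" where
  "socle_component I i = socle I \<inter> graded_component I i"

definition top_degree :: "('v::finite, 'k::field) mpoly set \<Rightarrow> nat" where
  "top_degree I = (GREATEST d. graded_component I d \<noteq> {\<zero>\<^bsub>quot_algebra I\<^esub>})"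

definition socle_vector :: "('v::finite, 'k::field) mpoly set \<Rightarrow> nat list" where
  "socle_vector I =
     map (\<lambda>i. ring.dim (quot_algebra I) (ground_field I) (socle_component I i))
       [0..<Suc (top_degree I)]"

definition level :: "('v::finite, 'k::field) mpoly set \<Rightarrow> bool" where
  "level I \<longleftrightarrow> (\<forall>i \<le> top_degree I. i \<noteq> top_degree I \<longrightarrow> socle_vector I ! i = 0)"

section \<open>The ideal defining $A(\Delta, a_1, \dots, a_n)$\<close>

definition stanley_reisner_ideal :: "'v::finite set set \<Rightarrow> ('v, 'k::field) mpoly set" where
  "stanley_reisner_ideal \<Delta> = Idl\<^bsub>poly_ring\<^esub> {\<Prod>v\<in>F. var v | F. F \<notin> \<Delta>}"

definition artinian_ideal :: "'v::finite set set \<Rightarrow> ('v \<Rightarrow> nat) \<Rightarrow> ('v, 'k::field) mpoly set" where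
  "artinian_ideal \<Delta> a =
     stanley_reisner_ideal \<Delta> <+>\<^bsub>poly_ring\<^esub> (Idl\<^bsub>poly_ring\<^esub> {var v ^ a v | v. True})"

end

theory Submission
  imports Defs
begin

text \<open>
  The ideal is monomial: it is spanned by the set \<open>U\<close> of monomials whose support is not a face or
  which are divisible by some \<open>x\<^sub>v\<close> to the power \<open>a\<^sub>v\<close>. Hence the socle is spanned by the monomials
  outside \<open>U\<close> that every variable sends into \<open>U\<close>; because \<open>a\<^sub>v \<ge> 2\<close>, these are the products of
  \<open>x\<^sub>v\<close> to the power \<open>a\<^sub>v - 1\<close> over the vertices \<open>v\<close> of a facet. The top degree is attained by one of
  them, so the algebra is level iff the degrees \<open>\<Sum>v\<in>F. (a\<^sub>v - 1)\<close> agree for all facets \<open>F\<close>.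
\<close>

section \<open>Monomial ideals\<close>

lemma poly_ring_simps:
  "carrier poly_ring = UNIV"
  "x \<oplus>\<^bsub>poly_ring\<^esub> y = x + y"
  "x \<otimes>\<^bsub>poly_ring\<^esub> y = x * y"
  "\<zero>\<^bsub>poly_ring\<^esub> = 0"
  "\<one>\<^bsub>poly_ring\<^esub> = 1"
  by (simp_all add: ring_of_type_algebra_def)

interpretation poly_ring: cring "poly_ring :: ('v::finite, 'k::field) mpoly ring"
  by (rule cring_from_type_algebra)

lemma poly_ring_uminus: "\<ominus>\<^bsub>poly_ring\<^esub> x = - (x :: ('v::finite, 'k::field) mpoly)"
  using poly_ring.minus_equality[of "- x" x] by (simp add: poly_ring_simps)

lemma poly_ring_minus: "x \<ominus>\<^bsub>poly_ring\<^esub> y = x - (y :: ('v::finite, 'k::field) mpoly)"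
  by (simp add: a_minus_def poly_ring_simps poly_ring_uminus)

text \<open>The k-span of the monomials with exponent in \<open>U\<close>, so membership is tested
  term by term. It is an ideal once \<open>U\<close> is closed under adding exponents.\<close>

definition monomial_ideal :: "('v \<Rightarrow>\<^sub>0 nat) set \<Rightarrow> ('v::finite, 'k::field) mpoly set" where
  "monomial_ideal U = {f. Poly_Mapping.keys f \<subseteq> U}"

lemma monomial_ideal_iff: "f \<in> monomial_ideal U \<longleftrightarrow> Poly_Mapping.keys f \<subseteq> U"
  by (simp add: monomial_ideal_def)

section \<open>Coefficients and supports under multiplication by a monomial\<close>

lemma poly_mapping_sum_singles:
  "(\<Sum>m\<in>Poly_Mapping.keys f. Poly_Mapping.single m (Poly_Mapping.lookup f m)) = f"
proof (rule poly_mapping_eqI)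
  fix k
  have "(\<Sum>m\<in>Poly_Mapping.keys f. Poly_Mapping.lookup (Poly_Mapping.single m (Poly_Mapping.lookup f m)) k)
      = (\<Sum>m\<in>Poly_Mapping.keys f. if k = m then Poly_Mapping.lookup f m else 0)"
    by (rule sum.cong) (auto simp: lookup_single when_def)
  also have "\<dots> = Poly_Mapping.lookup f k"
    by (auto simp: sum.delta in_keys_iff)
  finally show "Poly_Mapping.lookup
      (\<Sum>m\<in>Poly_Mapping.keys f. Poly_Mapping.single m (Poly_Mapping.lookup f m)) k
      = Poly_Mapping.lookup f k"
    by (simp add: lookup_sum)
qed

text \<open>Adding \<open>s\<close> to exponents is injective, so only the term of \<open>f\<close>
  at \<open>m\<close> contributes to the coefficient at \<open>m + s\<close>.\<close>

lemma lookup_mult_single: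
  fixes f :: "('v::finite, 'k::field) mpoly"
  shows "Poly_Mapping.lookup (f * Poly_Mapping.single s c) (m + s) = Poly_Mapping.lookup f m * c"
proof -
  have "f * Poly_Mapping.single s c
      = (\<Sum>n\<in>Poly_Mapping.keys f. Poly_Mapping.single n (Poly_Mapping.lookup f n))
        * Poly_Mapping.single s c"
    by (simp only: poly_mapping_sum_singles)
  also have "\<dots>
      = (\<Sum>n\<in>Poly_Mapping.keys f. Poly_Mapping.single (n + s) (Poly_Mapping.lookup f n * c))"
    by (simp add: sum_distrib_right mult_single)
  finally have "f * Poly_Mapping.single s c = \<dots>" .
  then have "Poly_Mapping.lookup (f * Poly_Mapping.single s c) (m + s)
      = (\<Sum>n\<in>Poly_Mapping.keys f. if m = n then Poly_Mapping.lookup f n * c else 0)"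
    by (auto simp: lookup_sum lookup_single when_def intro!: sum.cong)
  also have "\<dots> = Poly_Mapping.lookup f m * c"
    by (auto simp: sum.delta in_keys_iff)
  finally show ?thesis .
qed

text \<open>No two shifted terms meet, so nothing cancels; this sharpens the inclusion
  \<open>keys_mult\<close> to an equality.\<close>

lemma keys_mult_single:
  fixes f :: "('v::finite, 'k::field) mpoly"
  assumes "c \<noteq> 0"
  shows "Poly_Mapping.keys (f * Poly_Mapping.single s c) = (\<lambda>m. m + s) ` Poly_Mapping.keys f"
proof
  show "Poly_Mapping.keys (f * Poly_Mapping.single s c) \<subseteq> (\<lambda>m. m + s) ` Poly_Mapping.keys f"
    using keys_mult[of f "Poly_Mapping.single s c"] assms by auto
  show "(\<lambda>m. m + s) ` Poly_Mapping.keys f \<subseteq> Poly_Mapping.keys (f * Poly_Mapping.single s c)"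
    using assms by (auto simp: in_keys_iff lookup_mult_single)
qed

lemma ideal_monomial_ideal:
  assumes "\<And>m s. m \<in> U \<Longrightarrow> m + s \<in> U"
  shows "ideal (monomial_ideal U :: ('v::finite, 'k::field) mpoly set) poly_ring"
proof (rule idealI)
  show "ring (poly_ring :: ('v, 'k) mpoly ring)"
    by (rule poly_ring.ring_axioms)
  show "subgroup (monomial_ideal U) (add_monoid (poly_ring :: ('v, 'k) mpoly ring))"
  proof (rule poly_ring.add.subgroupI)
    have "(0 :: ('v, 'k) mpoly) \<in> monomial_ideal U"
      by (simp add: monomial_ideal_iff)
    then show "monomial_ideal U \<noteq> ({} :: ('v, 'k) mpoly set)"
      by blast
    show "\<ominus>\<^bsub>poly_ring\<^esub> f \<in> monomial_ideal U" if "f \<in> monomial_ideal U" for f :: "('v, 'k) mpoly"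
      using that by (auto simp: monomial_ideal_iff poly_ring_uminus in_keys_iff)
    show "f \<oplus>\<^bsub>poly_ring\<^esub> g \<in> monomial_ideal U"
      if "f \<in> monomial_ideal U" "g \<in> monomial_ideal U" for f g :: "('v, 'k) mpoly"
      using that keys_add[of f g] by (auto simp: monomial_ideal_iff poly_ring_simps)
  qed (simp add: poly_ring_simps)
next
  fix f g :: "('v, 'k) mpoly" assume f: "f \<in> monomial_ideal U"
  have "Poly_Mapping.keys (f * g) \<subseteq> U"
    using f keys_mult[of f g] assms by (force simp: monomial_ideal_iff)
  then show "f \<otimes>\<^bsub>poly_ring\<^esub> g \<in> monomial_ideal U" "g \<otimes>\<^bsub>poly_ring\<^esub> f \<in> monomial_ideal U"
    by (simp_all add: monomial_ideal_iff poly_ring_simps mult.commute)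
qed

text \<open>The multiples of the generating monomials form an up-closed set of exponents, whose span
  is an ideal containing the generators. Conversely, each term of an element of the span is a
  multiple of one generator.\<close>

lemma Idl_monomials:
  fixes T :: "('v::finite \<Rightarrow>\<^sub>0 nat) set"
  shows "Idl\<^bsub>poly_ring\<^esub> ((\<lambda>s. Poly_Mapping.single s (1 :: 'k::field)) ` T)
    = monomial_ideal {s + r | s r. s \<in> T}" (is "Idl\<^bsub>_\<^esub> ?G = _")
proof
  let ?U = "{s + r | s r. s \<in> T}"
  have "ideal (monomial_ideal ?U :: ('v, 'k) mpoly set) poly_ring"
    by (rule ideal_monomial_ideal) (auto simp: add.assoc, blast)
  moreover have "?G \<subseteq> monomial_ideal ?U"
    by (auto simp: monomial_ideal_iff) (metis add.right_neutral)
  ultimately show "Idl\<^bsub>poly_ring\<^esub> ?G \<subseteq> monomial_ideal ?U"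
    by (rule poly_ring.genideal_minimal)
  interpret I: ideal "Idl\<^bsub>poly_ring\<^esub> ?G" poly_ring
    by (rule poly_ring.genideal_ideal) (simp add: poly_ring_simps)
  have G: "?G \<subseteq> Idl\<^bsub>poly_ring\<^esub> ?G"
    by (rule poly_ring.genideal_self) (simp add: poly_ring_simps)
  have add: "x + y \<in> Idl\<^bsub>poly_ring\<^esub> ?G"
    if "x \<in> Idl\<^bsub>poly_ring\<^esub> ?G" "y \<in> Idl\<^bsub>poly_ring\<^esub> ?G" for x y
    using I.a_closed[OF that] by (simp add: poly_ring_simps)
  have zero: "0 \<in> Idl\<^bsub>poly_ring\<^esub> ?G"
    using I.zero_closed by (simp add: poly_ring_simps)
  have single: "Poly_Mapping.single m c \<in> Idl\<^bsub>poly_ring\<^esub> ?G" if m: "m \<in> ?U" for m and c :: 'k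
  proof -
    obtain s r where sr: "m = s + r" "s \<in> T" using m by blast
    have "Poly_Mapping.single s 1 * Poly_Mapping.single r c \<in> Idl\<^bsub>poly_ring\<^esub> ?G"
      using I.I_r_closed[of "Poly_Mapping.single s 1" "Poly_Mapping.single r c"] G sr(2)
      by (auto simp: poly_ring_simps)
    then show ?thesis by (simp add: mult_single sr)
  qed
  show "monomial_ideal ?U \<subseteq> Idl\<^bsub>poly_ring\<^esub> ?G"
  proof
    fix f :: "('v, 'k) mpoly" assume f: "f \<in> monomial_ideal ?U"
    \<comment> \<open>The support of \<open>f\<close> is generalized to any finite set
      \<open>A\<close> of exponents, so that the induction can run over \<open>A\<close> with
      \<open>f\<close> fixed.\<close>
    have "(\<Sum>m\<in>A. Poly_Mapping.single m (Poly_Mapping.lookup f m)) \<in> Idl\<^bsub>poly_ring\<^esub> ?G"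
      if "finite A" "A \<subseteq> ?U" for A
      using that by (induction) (auto intro!: add zero single)
    from this[of "Poly_Mapping.keys f"] f show "f \<in> Idl\<^bsub>poly_ring\<^esub> ?G"
      by (simp add: poly_mapping_sum_singles monomial_ideal_iff)
  qed
qed

text \<open>Serves to split a polynomial between two monomial ideals, and, with
  \<open>A = - U\<close>, to choose the normal form of a residue class.\<close>

lift_definition restrict_keys :: "'a set \<Rightarrow> ('a \<Rightarrow>\<^sub>0 'b::zero) \<Rightarrow> ('a \<Rightarrow>\<^sub>0 'b)"
  is "\<lambda>A f k. f k when k \<in> A"
  by (auto elim: rev_finite_subset)

lemma keys_restrict_keys: "Poly_Mapping.keys (restrict_keys A f) = Poly_Mapping.keys f \<inter> A"
  by transfer auto

lemma keys_diff_restrict_keys: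
  fixes f :: "'a \<Rightarrow>\<^sub>0 'b::ab_group_add"
  shows "Poly_Mapping.keys (f - restrict_keys A f) = Poly_Mapping.keys f - A"
  by transfer (auto simp: when_def)

lemma set_add_monomial_ideal:
  "monomial_ideal U <+>\<^bsub>poly_ring\<^esub> monomial_ideal V
    = (monomial_ideal (U \<union> V) :: ('v::finite, 'k::field) mpoly set)"
proof
  show "monomial_ideal U <+>\<^bsub>poly_ring\<^esub> monomial_ideal V
      \<subseteq> (monomial_ideal (U \<union> V) :: ('v, 'k) mpoly set)"
  proof
    fix h :: "('v, 'k) mpoly" assume "h \<in> monomial_ideal U <+>\<^bsub>poly_ring\<^esub> monomial_ideal V"
    then obtain f g where "f \<in> monomial_ideal U" "g \<in> monomial_ideal V" "h = f + g"
      by (auto simp: set_add_def' poly_ring_simps)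
    then show "h \<in> monomial_ideal (U \<union> V)"
      using keys_add[of f g] by (auto simp: monomial_ideal_iff)
  qed
  show "(monomial_ideal (U \<union> V) :: ('v, 'k) mpoly set)
      \<subseteq> monomial_ideal U <+>\<^bsub>poly_ring\<^esub> monomial_ideal V"
  proof
    fix h :: "('v, 'k) mpoly" assume "h \<in> monomial_ideal (U \<union> V)"
    then have "restrict_keys U h \<in> monomial_ideal U" "h - restrict_keys U h \<in> monomial_ideal V"
      by (auto simp: monomial_ideal_iff keys_restrict_keys keys_diff_restrict_keys)
    then have "restrict_keys U h + (h - restrict_keys U h)
        \<in> monomial_ideal U <+>\<^bsub>poly_ring\<^esub> monomial_ideal V"
      unfolding set_add_def' poly_ring_simps by blast
    then show "h \<in> monomial_ideal U <+>\<^bsub>poly_ring\<^esub> monomial_ideal V"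
      by simp
  qed
qed

section \<open>The socle of an artinian monomial algebra\<close>

definition monom_degree :: "('v::finite \<Rightarrow>\<^sub>0 nat) \<Rightarrow> nat" where
  "monom_degree m = (\<Sum>v\<in>UNIV. Poly_Mapping.lookup m v)"

lemma monom_degree_add: "monom_degree (m + n) = monom_degree m + monom_degree n"
  by (simp add: monom_degree_def lookup_add sum.distrib)

lemma monom_degree_single: "monom_degree (Poly_Mapping.single v n) = n"
  by (simp add: monom_degree_def lookup_single when_def)

text \<open>Monomials that survive in the quotient but are killed by every variable; their classes
  span the socle in each degree.\<close>

definition socle_monomials :: "('v::finite \<Rightarrow>\<^sub>0 nat) set \<Rightarrow> ('v \<Rightarrow>\<^sub>0 nat) set" where
  "socle_monomials U = {m. m \<notin> U \<and> (\<forall>v. m + Poly_Mapping.single v 1 \<in> U)}"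

lemma homogeneous_polys_iff:
  "f \<in> homogeneous_polys d \<longleftrightarrow> (\<forall>m\<in>Poly_Mapping.keys f. monom_degree m = d)"
  by (simp add: homogeneous_polys_def monom_degree_def)

lemma const_ring_hom:
  "ring_hom_ring (ring_of_type_algebra :: 'k::field ring) (poly_ring :: ('v::finite, 'k) mpoly ring) const"
  by (rule ring_hom_ringI2[OF ring_from_type_algebra ring_from_type_algebra])
    (rule ring_hom_memI;
      simp add: ring_of_type_algebra_def const_def single_add mult_single)

lemma subfield_const: "subfield (range const) (poly_ring :: ('v::finite, 'k::field) mpoly ring)"
proof -
  have "subfield (carrier (ring_of_type_algebra :: 'k ring)) ring_of_type_algebra"
    by (rule field.carrier_is_subfield[OF field_from_type_algebra])
  from ring_hom_ring.img_is_subfield(2)[OF const_ring_hom this] show ?thesis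
    by (simp add: ring_of_type_algebra_def)
qed

text \<open>The three assumptions make the span of \<open>U\<close> an ideal, the quotient
  finite-dimensional, and the quotient nonzero.\<close>

locale artinian_monomials =
  fixes U :: "('v::finite \<Rightarrow>\<^sub>0 nat) set"
  assumes add_closed: "m \<in> U \<Longrightarrow> m + s \<in> U"
    and finite_compl: "finite (- U)"
    and zero_notin: "0 \<notin> U"
begin

abbreviation (input) I :: "('v, 'k::field) mpoly set" where "I \<equiv> monomial_ideal U"

lemma ideal_I: "ideal I poly_ring"
  by (rule ideal_monomial_ideal) (rule add_closed)

section \<open>Residue classes modulo a monomial ideal\<close>

lemma residue_class_hom:
  "ring_hom_ring poly_ring (quot_algebra I) (residue_class (I :: ('v, 'k::field) mpoly set))"
  using ideal.rcos_ring_hom_ring[OF ideal_I] by (simp add: residue_class_def[abs_def])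

lemma carrier_quot: "carrier (quot_algebra I) = range (residue_class I)"
  by (auto simp: FactRing_def A_RCOSETS_def' residue_class_def poly_ring_simps)

lemma residue_class_eq_iff: "residue_class I f = residue_class I g \<longleftrightarrow> f - g \<in> I"
  using poly_ring.quotient_eq_iff_same_a_r_cos[OF ideal_I, of f g]
  by (simp add: residue_class_def poly_ring_simps poly_ring_minus)

lemma residue_class_zero: "residue_class I 0 = \<zero>\<^bsub>quot_algebra I\<^esub>"
  using ring_hom_zero[OF ring_hom_ring.homh[OF residue_class_hom] poly_ring.ring_axioms
      ideal.quotient_is_ring[OF ideal_I]]
  by (simp add: poly_ring_simps)

lemma residue_class_eq_zero_iff: "residue_class I f = \<zero>\<^bsub>quot_algebra I\<^esub> \<longleftrightarrow> f \<in> I"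
  unfolding residue_class_zero[symmetric] residue_class_eq_iff by simp

lemma residue_class_mult:
  "residue_class I f \<otimes>\<^bsub>quot_algebra I\<^esub> residue_class I g = residue_class I (f * g)"
  using ring_hom_mult[OF ring_hom_ring.homh[OF residue_class_hom], of f g] by (simp add: poly_ring_simps)

lemma residue_class_add:
  "residue_class I f \<oplus>\<^bsub>quot_algebra I\<^esub> residue_class I g = residue_class I (f + g)"
  using ring_hom_add[OF ring_hom_ring.homh[OF residue_class_hom], of f g] by (simp add: poly_ring_simps)

lemma residue_class_restrict_keys: "residue_class I (restrict_keys (- U) f) = residue_class I f"
proof -
  \<comment> \<open>In this orientation the difference to be tested is
    \<open>f - restrict_keys (- U) f\<close>, whose support is known to lie in
    \<open>U\<close>.\<close>
  have "residue_class I f = residue_class I (restrict_keys (- U) f)"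
    by (auto simp: residue_class_eq_iff monomial_ideal_iff keys_diff_restrict_keys)
  then show ?thesis ..
qed

text \<open>Multiplication by a variable shifts exponents without cancellation and membership in
  \<open>I\<close> is termwise, so annihilation can be checked on each monomial of \<open>f\<close>
  separately.\<close>

lemma residue_class_in_socle_iff:
  "residue_class I f \<in> socle I \<longleftrightarrow> Poly_Mapping.keys f \<subseteq> U \<union> socle_monomials U"
proof -
  have "residue_class I f \<in> socle I \<longleftrightarrow> (\<forall>v. f * var v \<in> I)"
    by (auto simp: socle_def carrier_quot residue_class_mult residue_class_eq_zero_iff)
  also have "\<dots> \<longleftrightarrow> (\<forall>v. \<forall>m\<in>Poly_Mapping.keys f. m + Poly_Mapping.single v 1 \<in> U)"
    by (auto simp: monomial_ideal_iff var_def keys_mult_single)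
  also have "\<dots> \<longleftrightarrow> Poly_Mapping.keys f \<subseteq> U \<union> socle_monomials U"
    using add_closed by (auto simp: socle_monomials_def)
  finally show ?thesis .
qed

text \<open>Dropping the terms in \<open>U\<close> from a homogeneous representative keeps it
  homogeneous and leaves only socle monomials.\<close>

lemma socle_component_eq:
  "socle_component (I :: ('v, 'k::field) mpoly set) d
    = residue_class I ` {f. Poly_Mapping.keys f \<subseteq> {m \<in> socle_monomials U. monom_degree m = d}}"
  (is "_ = _ ` {f. _ \<subseteq> ?S}")
proof
  have "f \<in> homogeneous_polys d" if "Poly_Mapping.keys f \<subseteq> ?S" for f :: "('v, 'k) mpoly"
    using that by (auto simp: homogeneous_polys_iff)
  then show "residue_class I ` {f. Poly_Mapping.keys f \<subseteq> ?S}
      \<subseteq> socle_component (I :: ('v, 'k) mpoly set) d"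
    by (auto simp: socle_component_def graded_component_def residue_class_in_socle_iff
        intro!: imageI)
  show "socle_component (I :: ('v, 'k) mpoly set) d \<subseteq> residue_class I ` {f. Poly_Mapping.keys f \<subseteq> ?S}"
  proof
    fix x assume "x \<in> socle_component (I :: ('v, 'k) mpoly set) d"
    then obtain f where f: "x = residue_class I f" "f \<in> homogeneous_polys d"
        "residue_class I f \<in> socle I"
      by (auto simp: socle_component_def graded_component_def)
    then have "Poly_Mapping.keys (restrict_keys (- U) f) \<subseteq> ?S"
      by (auto simp: residue_class_in_socle_iff homogeneous_polys_iff keys_restrict_keys)
    then show "x \<in> residue_class I ` {f. Poly_Mapping.keys f \<subseteq> ?S}"
      using f(1) residue_class_restrict_keys[of f] by (metis (mono_tags) imageI mem_Collect_eq)
  qed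
qed

text \<open>The image of a field in a nonzero ring is a subfield; the quotient is nonzero because
  the monomial 1 lies outside \<open>I\<close>.\<close>

lemma subfield_ground_field: "subfield (ground_field I) (quot_algebra (I :: ('v, 'k::field) mpoly set))"
proof -
  have "residue_class I (1 :: ('v, 'k) mpoly) \<noteq> \<zero>\<^bsub>quot_algebra I\<^esub>"
    using zero_notin by (simp add: residue_class_eq_zero_iff monomial_ideal_iff)
  then have "\<one>\<^bsub>quot_algebra (I :: ('v, 'k) mpoly set)\<^esub> \<noteq> \<zero>\<^bsub>quot_algebra I\<^esub>"
    using ring_hom_one[OF ring_hom_ring.homh[OF residue_class_hom[where 'k = 'k]]]
    by (simp add: poly_ring_simps)
  from ring_hom_ring.img_is_subfield(2)[OF residue_class_hom subfield_const this]
  show ?thesis by (simp add: ground_field_def)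
qed

text \<open>\<open>Span\<close> is recursive over a list: each further monomial contributes one free
  coefficient. This describes it by supports, the form used for socle components.\<close>

lemma Span_monomials:
  "ring.Span (quot_algebra (I :: ('v, 'k::field) mpoly set)) (ground_field I)
      (map (\<lambda>m. residue_class I (Poly_Mapping.single m 1)) ms)
    = residue_class I ` {f. Poly_Mapping.keys f \<subseteq> set ms}"
proof -
  interpret Q: ring "quot_algebra (I :: ('v, 'k) mpoly set)"
    by (rule ideal.quotient_is_ring[OF ideal_I])
  let ?c = "residue_class (I :: ('v, 'k) mpoly set)"
  show "Q.Span (ground_field I) (map (\<lambda>m. ?c (Poly_Mapping.single m 1)) ms)
    = ?c ` {f. Poly_Mapping.keys f \<subseteq> set ms}"
  proof (induction ms)
    case Nil
    show ?case by (simp add: residue_class_zero)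
  next
    case (Cons m ms)
    let ?A = "{f :: ('v, 'k) mpoly. Poly_Mapping.keys f \<subseteq> set ms}"
    have "Q.Span (ground_field I) (map (\<lambda>m. ?c (Poly_Mapping.single m 1)) (m # ms))
        = Q.line_extension (ground_field I) (?c (Poly_Mapping.single m 1)) (?c ` ?A)"
      using Cons.IH by simp
    also have "\<dots> = {?c (Poly_Mapping.single m k + f) | k f. f \<in> ?A}"
      unfolding Q.line_extension_def
      by (auto simp: set_add_def' r_coset_def ground_field_def residue_class_mult
          residue_class_add const_def mult_single)
    also have "\<dots> = ?c ` {f. Poly_Mapping.keys f \<subseteq> set (m # ms)}"
    proof (intro subset_antisym subsetI)
      fix x assume "x \<in> {?c (Poly_Mapping.single m k + f) | k f. f \<in> ?A}"
      then obtain k f where "x = ?c (Poly_Mapping.single m k + f)" "f \<in> ?A" by blast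
      then show "x \<in> ?c ` {f. Poly_Mapping.keys f \<subseteq> set (m # ms)}"
        using keys_add[of "Poly_Mapping.single m k" f] by (auto split: if_splits)
    next
      fix x assume "x \<in> ?c ` {f. Poly_Mapping.keys f \<subseteq> set (m # ms)}"
      then obtain f where f: "x = ?c f" "Poly_Mapping.keys f \<subseteq> set (m # ms)" by blast
      let ?s = "Poly_Mapping.single m (Poly_Mapping.lookup f m)"
      \<comment> \<open>Removing the whole term at \<open>m\<close> makes the coefficient there
        zero, so the rest is supported in \<open>set ms\<close>.\<close>
      have "f - ?s \<in> ?A"
        using f(2) by (auto simp: in_keys_iff lookup_minus lookup_single when_def split: if_splits)
      moreover have "x = ?c (?s + (f - ?s))" using f(1) by simp
      ultimately show "x \<in> {?c (Poly_Mapping.single m k + f) | k f. f \<in> ?A}" by blast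
    qed
    finally show ?case .
  qed
qed

text \<open>Dimension zero means the zero space, and the component is zero exactly when it has no
  spanning monomial, as the class of a monomial outside \<open>U\<close> is nonzero.\<close>

lemma dim_socle_component_eq_0_iff:
  "ring.dim (quot_algebra I) (ground_field I) (socle_component (I :: ('v, 'k::field) mpoly set) d) = 0
    \<longleftrightarrow> (\<forall>m\<in>socle_monomials U. monom_degree m \<noteq> d)"
proof -
  let ?S = "{m \<in> socle_monomials U. monom_degree m = d}"
  let ?K = "ground_field (I :: ('v, 'k) mpoly set)"
  let ?E = "socle_component (I :: ('v, 'k) mpoly set) d"
  interpret Q: ring "quot_algebra (I :: ('v, 'k) mpoly set)"
    by (rule ideal.quotient_is_ring[OF ideal_I])
  have "finite ?S"
    by (rule finite_subset[OF _ finite_compl]) (auto simp: socle_monomials_def)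
  then obtain ms where ms: "set ms = ?S"
    using finite_list by blast
  \<comment> \<open>Finite dimension must come first: only then does the number \<open>dim\<close>
    certify a dimension, so that its vanishing forces the zero space.\<close>
  have "Q.finite_dimension ?K (Q.Span ?K
      (map (\<lambda>m. residue_class I (Poly_Mapping.single m 1)) ms))"
    by (rule Q.Span_finite_dimension[OF subfield_ground_field]) (auto simp: carrier_quot)
  then have fin: "Q.finite_dimension ?K ?E"
    by (simp only: Span_monomials ms socle_component_eq)
  have "Q.dim ?K ?E = 0 \<longleftrightarrow> ?E = {\<zero>\<^bsub>quot_algebra I\<^esub>}"
  proof
    assume "Q.dim ?K ?E = 0"
    then show "?E = {\<zero>\<^bsub>quot_algebra I\<^esub>}"
      using Q.finite_dimensionE[OF subfield_ground_field fin]
      by (intro Q.dimension_zero[OF subfield_ground_field]) (simp add: over_def)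
  next
    assume E: "?E = {\<zero>\<^bsub>quot_algebra I\<^esub>}"
    show "Q.dim ?K ?E = 0"
      using Q.dimI[OF subfield_ground_field Q.zero_dim] by (simp add: E over_def)
  qed
  also have "\<dots> \<longleftrightarrow> ?S = {}"
  proof
    assume E: "?E = {\<zero>\<^bsub>quot_algebra I\<^esub>}"
    show "?S = {}"
    proof (rule ccontr)
      assume "?S \<noteq> {}"
      then obtain m where m: "m \<in> ?S" by blast
      then have "residue_class I (Poly_Mapping.single m 1) \<in> ?E"
        unfolding socle_component_eq by auto
      then have "m \<in> U"
        by (simp add: E residue_class_eq_zero_iff monomial_ideal_iff)
      with m show False by (simp add: socle_monomials_def)
    qed
  next
    assume "?S = {}"
    then show "?E = {\<zero>\<^bsub>quot_algebra I\<^esub>}"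
      by (simp only: socle_component_eq) (simp add: residue_class_zero)
  qed
  finally show ?thesis by auto
qed

section \<open>The top degree and the level property in terms of monomials\<close>

lemma graded_component_eq_zero_iff:
  "graded_component (I :: ('v, 'k::field) mpoly set) d = {\<zero>\<^bsub>quot_algebra I\<^esub>}
    \<longleftrightarrow> (\<forall>m. monom_degree m = d \<longrightarrow> m \<in> U)"
proof
  assume Z: "graded_component (I :: ('v, 'k) mpoly set) d = {\<zero>\<^bsub>quot_algebra I\<^esub>}"
  show "\<forall>m. monom_degree m = d \<longrightarrow> m \<in> U"
  proof (intro allI impI)
    fix m :: "'v \<Rightarrow>\<^sub>0 nat" assume "monom_degree m = d"
    then have "residue_class I (Poly_Mapping.single m 1)
        \<in> graded_component (I :: ('v, 'k) mpoly set) d"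
      by (auto simp: graded_component_def homogeneous_polys_iff)
    then show "m \<in> U"
      by (simp add: Z residue_class_eq_zero_iff monomial_ideal_iff)
  qed
next
  assume U: "\<forall>m. monom_degree m = d \<longrightarrow> m \<in> U"
  have "residue_class I f = \<zero>\<^bsub>quot_algebra I\<^esub>" if "f \<in> homogeneous_polys d" for f :: "('v, 'k) mpoly"
    using that U by (auto simp: residue_class_eq_zero_iff monomial_ideal_iff homogeneous_polys_iff)
  moreover have "(0 :: ('v, 'k) mpoly) \<in> homogeneous_polys d"
    by (simp add: homogeneous_polys_iff)
  ultimately show "graded_component (I :: ('v, 'k) mpoly set) d = {\<zero>\<^bsub>quot_algebra I\<^esub>}"
    by (auto simp: graded_component_def image_iff)
qed

text \<open>The \<open>GREATEST\<close> is attained because the complement of \<open>U\<close> is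
  finite and contains \<open>0\<close>.\<close>

lemma top_degree_eq_Max: "top_degree (I :: ('v, 'k::field) mpoly set) = Max (monom_degree ` (- U))"
proof -
  have "top_degree (I :: ('v, 'k) mpoly set) = (GREATEST d. d \<in> monom_degree ` (- U))"
    unfolding top_degree_def graded_component_eq_zero_iff
    by (rule arg_cong[where f = Greatest]) auto
  also have "\<dots> = Max (monom_degree ` (- U))"
    using finite_compl zero_notin
    by (intro Greatest_equality Max_in Max_ge finite_imageI) auto
  finally show ?thesis .
qed

lemma monom_degree_le_top_degree:
  "m \<notin> U \<Longrightarrow> monom_degree m \<le> top_degree (I :: ('v, 'k::field) mpoly set)"
  unfolding top_degree_eq_Max using finite_compl by (intro Max_ge finite_imageI imageI) auto

text \<open>Multiplying a monomial of maximal degree outside \<open>U\<close> by any variable lands in \<open>U\<close>.\<close>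

lemma top_degree_socle_monomial:
  "\<exists>m\<in>socle_monomials U. monom_degree m = top_degree (I :: ('v, 'k::field) mpoly set)"
proof -
  have "top_degree (I :: ('v, 'k) mpoly set) \<in> monom_degree ` (- U)"
    unfolding top_degree_eq_Max using finite_compl zero_notin by (intro Max_in finite_imageI) auto
  then obtain m where m: "m \<notin> U" "monom_degree m = top_degree (I :: ('v, 'k) mpoly set)"
    by auto
  have "m + Poly_Mapping.single v 1 \<in> U" for v
    using monom_degree_le_top_degree[of "m + Poly_Mapping.single v 1", where 'k = 'k] m(2)
    by (auto simp: monom_degree_add monom_degree_single)
  with m show ?thesis by (auto simp: socle_monomials_def)
qed

text \<open>Level means that all socle monomials have the top degree. As some socle monomial attains
  it, this is the same as all their degrees agreeing, a condition that no longer mentions the top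
  degree.\<close>

lemma level_iff:
  "level (I :: ('v, 'k::field) mpoly set) \<longleftrightarrow>
    (\<forall>m\<in>socle_monomials U. \<forall>n\<in>socle_monomials U. monom_degree m = monom_degree n)"
proof -
  let ?e = "top_degree (I :: ('v, 'k) mpoly set)"
  have "level (I :: ('v, 'k) mpoly set) \<longleftrightarrow>
      (\<forall>i\<le>?e. i \<noteq> ?e \<longrightarrow> (\<forall>m\<in>socle_monomials U. monom_degree m \<noteq> i))"
    by (auto simp del: upt_Suc simp: level_def socle_vector_def dim_socle_component_eq_0_iff)
  also have "\<dots> \<longleftrightarrow> (\<forall>m\<in>socle_monomials U. monom_degree m = ?e)"
    using monom_degree_le_top_degree[where 'k = 'k] by (auto simp: socle_monomials_def)
  also have "\<dots> \<longleftrightarrow>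
      (\<forall>m\<in>socle_monomials U. \<forall>n\<in>socle_monomials U. monom_degree m = monom_degree n)"
    using top_degree_socle_monomial[where 'k = 'k] by metis
  finally show ?thesis .
qed

end

section \<open>The algebra of a simplicial complex\<close>

definition vanishing_monomials :: "'v::finite set set \<Rightarrow> ('v \<Rightarrow> nat) \<Rightarrow> ('v \<Rightarrow>\<^sub>0 nat) set" where
  "vanishing_monomials \<Delta> a
    = {m. Poly_Mapping.keys m \<notin> \<Delta>} \<union> {m. \<exists>v. a v \<le> Poly_Mapping.lookup m v}"

lift_definition facet_monomial :: "('v::finite \<Rightarrow> nat) \<Rightarrow> 'v set \<Rightarrow> ('v \<Rightarrow>\<^sub>0 nat)"
  is "\<lambda>a F v. if v \<in> F then a v - 1 else 0"
  by simp

text \<open>Natural exponents cannot cancel.\<close>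

lemma keys_add_nat:
  "Poly_Mapping.keys (m + n :: 'v \<Rightarrow>\<^sub>0 nat) = Poly_Mapping.keys m \<union> Poly_Mapping.keys n"
  by (auto simp: in_keys_iff lookup_add)

lemma prod_var:
  "(\<Prod>v\<in>F. var v :: ('v::finite, 'k::field) mpoly)
    = Poly_Mapping.single (\<Sum>v\<in>F. Poly_Mapping.single v 1) 1"
  by (induction F rule: infinite_finite_induct) (simp_all add: var_def mult_single)

lemma var_power:
  "var v ^ n = (Poly_Mapping.single (Poly_Mapping.single v n) 1 :: ('v::finite, 'k::field) mpoly)"
  by (induction n) (simp_all add: var_def mult_single flip: single_add)

lemma lookup_sum_single:
  "Poly_Mapping.lookup (\<Sum>v\<in>F. Poly_Mapping.single v (1::nat)) (w::'v::finite) = (if w \<in> F then 1 else 0)"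
  by (simp add: lookup_sum lookup_single when_def)

text \<open>Both summands are generated by monomials, so it suffices to find the multiples of the
  generators. Non-faces are closed under supersets, hence a monomial is a multiple of some non-face
  product exactly when its own support is a non-face.\<close>

lemma artinian_ideal_eq:
  assumes "simplicial_complex \<Delta>"
  shows "artinian_ideal \<Delta> a
    = (monomial_ideal (vanishing_monomials \<Delta> a) :: ('v::finite, 'k::field) mpoly set)"
proof -
  let ?T = "(\<lambda>F. \<Sum>v\<in>F. Poly_Mapping.single v (1::nat)) ` (- \<Delta>)"
  let ?T' = "range (\<lambda>v. Poly_Mapping.single v (a v))"
  have "{\<Prod>v\<in>F. var v | F. F \<notin> \<Delta>} = (\<lambda>s. Poly_Mapping.single s (1::'k)) ` ?T"
    by (auto simp: prod_var)
  moreover have "{s + r | s r. s \<in> ?T} = {m. Poly_Mapping.keys m \<notin> \<Delta>}"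
  proof (intro subset_antisym subsetI)
    fix m assume "m \<in> {s + r | s r. s \<in> ?T}"
    then obtain F r where F: "F \<notin> \<Delta>" "m = (\<Sum>v\<in>F. Poly_Mapping.single v 1) + r"
      by auto
    have "F \<subseteq> Poly_Mapping.keys m"
      by (auto simp: F in_keys_iff lookup_add lookup_sum_single simp del: One_nat_def)
    with F(1) assms show "m \<in> {m. Poly_Mapping.keys m \<notin> \<Delta>}"
      by (auto simp: simplicial_complex_def)
  next
    fix m :: "'v \<Rightarrow>\<^sub>0 nat" assume m: "m \<in> {m. Poly_Mapping.keys m \<notin> \<Delta>}"
    let ?s = "\<Sum>v\<in>Poly_Mapping.keys m. Poly_Mapping.single v (1::nat)"
    \<comment> \<open>The squarefree monomial on the full support of \<open>m\<close> divides
      \<open>m\<close>: exponents there are at least 1, so truncated subtraction is exact.\<close>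
    have "m = ?s + (m - ?s)"
      by (rule poly_mapping_eqI) (auto simp: lookup_add lookup_minus lookup_sum_single in_keys_iff simp del: One_nat_def)
    with m show "m \<in> {s + r | s r. s \<in> ?T}" by blast
  qed
  ultimately have SR: "stanley_reisner_ideal \<Delta>
      = (monomial_ideal {m. Poly_Mapping.keys m \<notin> \<Delta>} :: ('v, 'k) mpoly set)"
    by (simp add: stanley_reisner_ideal_def Idl_monomials)
  have "{var v ^ a v | v. True} = (\<lambda>s. Poly_Mapping.single s (1::'k)) ` ?T'"
    by (auto simp: var_power)
  moreover have "{s + r | s r. s \<in> ?T'} = {m. \<exists>v. a v \<le> Poly_Mapping.lookup m v}"
  proof (intro subset_antisym subsetI)
    fix m assume "m \<in> {s + r | s r. s \<in> ?T'}"
    then obtain v r where "m = Poly_Mapping.single v (a v) + r" by auto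
    then have "a v \<le> Poly_Mapping.lookup m v" by (simp add: lookup_add)
    then show "m \<in> {m. \<exists>v. a v \<le> Poly_Mapping.lookup m v}" by blast
  next
    fix m assume "m \<in> {m. \<exists>v. a v \<le> Poly_Mapping.lookup m v}"
    then obtain v where v: "a v \<le> Poly_Mapping.lookup m v" by blast
    have "m = Poly_Mapping.single v (a v) + (m - Poly_Mapping.single v (a v))"
      by (rule poly_mapping_eqI) (use v in \<open>auto simp: lookup_add lookup_minus lookup_single when_def\<close>)
    then show "m \<in> {s + r | s r. s \<in> ?T'}" by blast
  qed
  ultimately have "Idl\<^bsub>poly_ring\<^esub> {var v ^ a v | v. True}
      = (monomial_ideal {m. \<exists>v. a v \<le> Poly_Mapping.lookup m v} :: ('v, 'k) mpoly set)"
    by (simp add: Idl_monomials)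
  then show ?thesis
    by (simp add: artinian_ideal_def SR set_add_monomial_ideal vanishing_monomials_def)
qed

lemma artinian_monomials_vanishing_monomials:
  assumes "simplicial_complex \<Delta>" and a: "\<And>v. a v \<ge> 2"
  shows "artinian_monomials (vanishing_monomials \<Delta> a)"
proof
  fix m s assume "m \<in> vanishing_monomials \<Delta> a"
  then show "m + s \<in> vanishing_monomials \<Delta> a"
    using assms(1) unfolding vanishing_monomials_def simplicial_complex_def
    by (auto simp: keys_add_nat lookup_add intro: trans_le_add1)
next
  \<comment> \<open>Surviving exponent vectors lie in the finite box of functions bounded by
    \<open>a\<close>, and \<open>lookup\<close> is injective.\<close>
  have "finite (Poly_Mapping.lookup ` (- vanishing_monomials \<Delta> a))"
  proof (rule finite_subset)
    show "Poly_Mapping.lookup ` (- vanishing_monomials \<Delta> a) \<subseteq> (\<Pi>\<^sub>E v\<in>UNIV. {..<a v})"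
      by (auto simp: vanishing_monomials_def not_le)
  qed (auto intro: finite_PiE)
  then show "finite (- vanishing_monomials \<Delta> a)"
    by (rule finite_imageD) (simp add: inj_on_def)
next
  have "{} \<in> \<Delta>"
    using assms(1) unfolding simplicial_complex_def by blast
  moreover have "\<not> a v \<le> 0" for v
    using a[of v] by simp
  ultimately show "0 \<notin> vanishing_monomials \<Delta> a"
    by (simp add: vanishing_monomials_def)
qed

text \<open>Multiplying by a variable in the support can only vanish by reaching the bound, so its
  exponent is \<open>a v - 1\<close>. A variable outside gets exponent 1, below \<open>a v\<close>,
  so it must turn the support into a non-face; thus the support is a facet.\<close>

lemma socle_monomials_vanishing_monomials:
  assumes "simplicial_complex \<Delta>" and a: "\<And>v. a v \<ge> 2"
  shows "socle_monomials (vanishing_monomials \<Delta> a) = facet_monomial a ` facets \<Delta>"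
proof (intro subset_antisym subsetI)
  fix m assume "m \<in> socle_monomials (vanishing_monomials \<Delta> a)"
  then have face: "Poly_Mapping.keys m \<in> \<Delta>" and less: "\<And>v. Poly_Mapping.lookup m v < a v"
    and max: "\<And>v. insert v (Poly_Mapping.keys m) \<notin> \<Delta>
      \<or> (\<exists>w. a w \<le> Poly_Mapping.lookup (m + Poly_Mapping.single v 1) w)"
    by (auto simp: socle_monomials_def vanishing_monomials_def not_le keys_add_nat)
  \<comment> \<open>Only the exponent of \<open>v\<close> grows, so the bound can be reached at no
    other vertex.\<close>
  have max': "insert v (Poly_Mapping.keys m) \<notin> \<Delta> \<or> a v \<le> Poly_Mapping.lookup m v + 1" for v
  proof -
    have "w = v \<and> a v \<le> Poly_Mapping.lookup m v + 1"
      if "a w \<le> Poly_Mapping.lookup (m + Poly_Mapping.single v 1) w" for w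
      using that less[of w] by (auto simp: lookup_add lookup_single when_def split: if_splits)
    with max[of v] show ?thesis by blast
  qed
  have "Poly_Mapping.keys m \<in> facets \<Delta>"
  proof -
    have "G = Poly_Mapping.keys m" if G: "G \<in> \<Delta>" "Poly_Mapping.keys m \<subseteq> G" for G
    proof (rule ccontr)
      assume "G \<noteq> Poly_Mapping.keys m"
      then obtain v where v: "v \<in> G" "v \<notin> Poly_Mapping.keys m" using G by blast
      then have "insert v (Poly_Mapping.keys m) \<in> \<Delta>"
        using G assms(1) unfolding simplicial_complex_def by blast
      \<comment> \<open>The exponent of \<open>v\<close> is 0, so the remaining alternative would
        give \<open>a v \<le> 1\<close>.\<close>
      with max'[of v] v(2) a[of v] show False by (simp add: in_keys_iff)
    qed
    with face show ?thesis by (auto simp: facets_def)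
  qed
  moreover have "m = facet_monomial a (Poly_Mapping.keys m)"
  proof (rule poly_mapping_eqI)
    fix v
    show "Poly_Mapping.lookup m v = Poly_Mapping.lookup (facet_monomial a (Poly_Mapping.keys m)) v"
    proof (cases "v \<in> Poly_Mapping.keys m")
      case True
      then show ?thesis
        using max'[of v] less[of v] face by (simp add: facet_monomial.rep_eq insert_absorb)
    qed (simp add: facet_monomial.rep_eq in_keys_iff)
  qed
  ultimately show "m \<in> facet_monomial a ` facets \<Delta>" by blast
next
  fix m assume "m \<in> facet_monomial a ` facets \<Delta>"
  then obtain F where F: "F \<in> facets \<Delta>" "m = facet_monomial a F" by blast
  have a': "\<not> a v \<le> 0" "\<not> a v \<le> a v - Suc 0" for v
    using a[of v] by auto
  \<comment> \<open>Since \<open>a v - 1\<close> is at least 1, no vertex of \<open>F\<close> drops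
    out of the support.\<close>
  have keys: "Poly_Mapping.keys m = F"
    using a by (auto simp: F facet_monomial.rep_eq in_keys_iff not_le Suc_le_eq numeral_2_eq_2
        split: if_splits)
  have "Poly_Mapping.lookup m v < a v" for v
    using a'[of v] by (simp add: F facet_monomial.rep_eq)
  then have "m \<notin> vanishing_monomials \<Delta> a"
    using F(1) by (simp add: vanishing_monomials_def keys facets_def not_le)
  moreover have "m + Poly_Mapping.single v 1 \<in> vanishing_monomials \<Delta> a" for v
  proof (cases "v \<in> F")
    case True
    then have "a v \<le> Poly_Mapping.lookup (m + Poly_Mapping.single v 1) v"
      by (simp add: F lookup_add facet_monomial.rep_eq)
    then show ?thesis by (auto simp: vanishing_monomials_def)
  next
    case False
    then have "insert v F \<notin> \<Delta>" using F(1) by (auto simp: facets_def)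
    then show ?thesis by (simp add: vanishing_monomials_def keys_add_nat keys)
  qed
  ultimately show "m \<in> socle_monomials (vanishing_monomials \<Delta> a)"
    by (simp add: socle_monomials_def)
qed

text \<open>Over the integers the truncated \<open>a v - 1\<close> becomes a true difference, which
  brings the socle degree into the shape of the linear equations.\<close>

lemma monom_degree_facet_monomial:
  assumes "\<And>v. a v \<ge> 2"
  shows "int (monom_degree (facet_monomial a F)) = (\<Sum>v\<in>F. int (a v)) - int (card F)"
proof -
  have "monom_degree (facet_monomial a F) = (\<Sum>v\<in>F. a v - 1)"
    by (simp add: monom_degree_def facet_monomial.rep_eq sum.If_cases)
  also have "int \<dots> = (\<Sum>v\<in>F. int (a v) - 1)"
    using assms by (auto simp: of_nat_diff intro!: sum.cong) (metis One_nat_def Suc_1 Suc_leD of_nat_1 of_nat_diff)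
  finally show ?thesis by (simp add: sum_subtractf)
qed

section \<open>Levelness as equality of consecutive facet degrees\<close>

theorem theorem4p1:
  fixes \<Delta> :: "'v::finite set set"
    and F :: "nat \<Rightarrow> 'v set"
    and t :: nat
    and a :: "'v \<Rightarrow> nat"
  assumes "simplicial_complex \<Delta>"
    and "bij_betw F {1..t} (facets \<Delta>)"
    and "t \<ge> 2"
    and "\<forall>G \<in> facets \<Delta>. card G \<noteq> 1"
    and "\<forall>v. a v \<ge> 2"
  shows "level (artinian_ideal \<Delta> a :: ('v, 'k::field_char_0) mpoly set) \<longleftrightarrow>
    (\<forall>i \<in> {1..t-1}. (\<Sum>v\<in>F i. int (a v)) - (\<Sum>v\<in>F (i + 1). int (a v))
        = int (card (F i)) - int (card (F (i + 1))))"
proof -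
  interpret artinian_monomials "vanishing_monomials \<Delta> a"
    using assms(1,5) by (intro artinian_monomials_vanishing_monomials) auto
  \<comment> \<open>The degree of the socle monomial of the \<open>i\<close>-th facet; equation
    \<open>i\<close> rearranges to \<open>D i = D (i + 1)\<close>.\<close>
  define D where "D i = int (monom_degree (facet_monomial a (F i)))" for i
  have D: "D i = (\<Sum>v\<in>F i. int (a v)) - int (card (F i))" for i
    unfolding D_def using assms(5) by (intro monom_degree_facet_monomial) auto
  have facets: "facets \<Delta> = F ` {1..t}"
    using assms(2) by (simp add: bij_betw_def)
  have "level (artinian_ideal \<Delta> a :: ('v, 'k) mpoly set) \<longleftrightarrow> (\<forall>i\<in>{1..t}. \<forall>j\<in>{1..t}. D i = D j)"
    using assms(1,5)
    by (simp add: artinian_ideal_eq level_iff socle_monomials_vanishing_monomials facets D_def)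
  also have "\<dots> \<longleftrightarrow> (\<forall>i\<in>{1..t-1}. D i = D (i + 1))"
  proof
    assume step: "\<forall>i\<in>{1..t-1}. D i = D (i + 1)"
    \<comment> \<open>Upward induction from 1 chains the consecutive equalities. The bound
      \<open>i \<le> t\<close> stays in the claim: at \<open>n + 1 \<le> t\<close> the index
      \<open>n\<close> lies in \<open>{1..t-1}\<close>, so its equation is available.\<close>
    have D_const: "i \<le> t \<longrightarrow> D i = D 1" if "1 \<le> i" for i
      using that
    proof (induction i rule: dec_induct)
      case (step n)
      then show ?case using \<open>\<forall>i\<in>{1..t-1}. D i = D (i + 1)\<close> by auto
    qed simp
    then show "\<forall>i\<in>{1..t}. \<forall>j\<in>{1..t}. D i = D j"
      by (metis D_const atLeastAtMost_iff)
  qed auto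
  also have "\<dots> \<longleftrightarrow> (\<forall>i \<in> {1..t-1}. (\<Sum>v\<in>F i. int (a v)) - (\<Sum>v\<in>F (i + 1). int (a v))
        = int (card (F i)) - int (card (F (i + 1))))"
    by (intro ball_cong) (auto simp: D)
  finally show ?thesis .
qed

end
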